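(* For every integer $n\ge 1$, the origami flip graph $\mathrm{OFG}(A_{2n})$ is connected and has diameter $n$.
   Context: $A_{2n}$ is the crease pattern with a single interior vertex of degree $2n$, creases $e_1,\dots,e_{2n}$ in cyclic order, all consecutive angles equal to $\pi/n$, and faces $\alpha_1,\dots,\alpha_{2n}$, where $\alpha_i$ is the face between $e_i$ and $e_{i+1}$ (indices cyclic mod $2n$). A mountain-valley (MV) assignment is a function $\mu:\{e_1,\dots,e_{2n}\}\to\{-1,1\}$ ($1$ = mountain, $-1$ = valley). It is valid if it can be used to fold the paper flat without self-intersection; for $A_{2n}$ this is known to be equivalent to $\sum_{i=1}^{2n}\mu(e_i)=\pm 2$, which may be taken as the definition. For a face $\alpha_i$, $\mu_{\alpha_i}$ denotes the MV assignment obtained from $\mu$ by changing the sign on exactly the two creases $e_i,e_{i+1}$ bordering $\alpha_i$. The origami flip graph $\mathrm{OFG}(A_{2n})$ is the graph whose vertices are all valid MV assignments of $A_{2n}$, with $\mu$ and $\nu$ joined by an edge if and only if $\nu=\mu_{\alpha_i}$ for some face $\alpha_i$. *)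

theory Defs
  imports "Graph_Theory.Graph_Theory" "HOL-Library.FuncSet"
begin

text \<open>
  The crease \<open>e\<^sub>i\<close> and the face \<open>\<alpha>\<^sub>i\<close> of \<open>A\<^sub>2\<^sub>n\<close> are both represented by their index
  \<open>i \<in> {1..2 * n}\<close>. Geometry enters only through the validity criterion: since all consecutive
  angles of \<open>A\<^sub>2\<^sub>n\<close> equal \<open>\<pi> / n\<close>, an assignment folds flat iff its signs add up to \<open>2\<close> or \<open>- 2\<close>.
\<close>

definition creases :: "nat \<Rightarrow> nat set" where
  "creases n = {1..2 * n}"

definition faces :: "nat \<Rightarrow> nat set" where
  "faces n = {1..2 * n}"

definition next_crease :: "nat \<Rightarrow> nat \<Rightarrow> nat" where
  "next_crease n i = (if i = 2 * n then 1 else i + 1)"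

definition face_creases :: "nat \<Rightarrow> nat \<Rightarrow> nat set" where
  "face_creases n i = {i, next_crease n i}"

text \<open>
  The extensional function space makes assignments that agree on all creases equal.
  The value \<open>1\<close> stands for a mountain, \<open>- 1\<close> for a valley.
\<close>

definition MV_assignments :: "nat \<Rightarrow> (nat \<Rightarrow> int) set" where
  "MV_assignments n = creases n \<rightarrow>\<^sub>E {- 1, 1}"

definition valid_MV_assignments :: "nat \<Rightarrow> (nat \<Rightarrow> int) set" where
  "valid_MV_assignments n =
    {m \<in> MV_assignments n. (\<Sum>i\<in>creases n. m i) = 2 \<or> (\<Sum>i\<in>creases n. m i) = - 2}"

definition flip_face :: "nat \<Rightarrow> (nat \<Rightarrow> int) \<Rightarrow> nat \<Rightarrow> (nat \<Rightarrow> int)" where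
  "flip_face n m i = (\<lambda>j. if j \<in> face_creases n i then - m j else m j)"

text \<open>
  The undirected edge between two assignments is represented by the two opposite arcs; the
  result is a finite simple graph, see \<open>pair_graph_OFG\<close> below.
\<close>

definition OFG :: "nat \<Rightarrow> (nat \<Rightarrow> int) pair_pre_digraph" where
  "OFG n =
    \<lparr> pverts = valid_MV_assignments n,
      parcs = {(m, m'). m \<in> valid_MV_assignments n \<and> m' \<in> valid_MV_assignments n \<and>
                 (\<exists>i\<in>faces n. m' = flip_face n m i)} \<rparr>"

text \<open>
  The cost of a walk under unit weights is its length, so \<open>graph_dist\<close> is the length of a
  shortest walk, and \<open>\<infinity>\<close> if there is none (for \<open>wf_digraph G\<close>, see \<open>graph_dist_conv_length\<close> below).
\<close>

definition graph_dist :: "('a, 'b) pre_digraph \<Rightarrow> 'a \<Rightarrow> 'a \<Rightarrow> ereal" where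
  "graph_dist G u v = wf_digraph.\<mu> G (\<lambda>_. 1) u v"

definition diameter :: "('a, 'b) pre_digraph \<Rightarrow> ereal" where
  "diameter G = (SUP u\<in>verts G. SUP v\<in>verts G. graph_dist G u v)"

lemma face_creases_subset: "i \<in> faces n \<Longrightarrow> face_creases n i \<subseteq> creases n"
  by (auto simp: faces_def face_creases_def creases_def next_crease_def)

lemma flip_face_flip_face: "flip_face n (flip_face n m i) i = m"
  by (auto simp: flip_face_def)

lemma flip_face_neq:
  assumes "m \<in> MV_assignments n" "i \<in> faces n"
  shows "flip_face n m i \<noteq> m"
proof -
  have "m i \<in> {- 1, 1}"
    using assms by (auto simp: MV_assignments_def faces_def creases_def PiE_iff)
  then have "flip_face n m i i \<noteq> m i"
    by (auto simp: flip_face_def face_creases_def)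
  then show ?thesis by metis
qed

lemma finite_valid_MV_assignments: "finite (valid_MV_assignments n)"
  by (simp add: valid_MV_assignments_def MV_assignments_def creases_def finite_PiE)

lemma pair_graph_OFG: "pair_graph (OFG n)"
proof
  show "finite (pverts (OFG n))"
    by (simp add: OFG_def finite_valid_MV_assignments)
  have "parcs (OFG n) \<subseteq> valid_MV_assignments n \<times> valid_MV_assignments n"
    by (auto simp: OFG_def)
  then show "finite (parcs (OFG n))"
    by (rule finite_subset) (simp add: finite_valid_MV_assignments)
  show "symmetric (with_proj (OFG n))"
    by (auto simp: symmetric_def sym_def OFG_def) (metis flip_face_flip_face)
  show "fst e \<noteq> snd e" if "e \<in> parcs (OFG n)" for e
    using that flip_face_neq by (fastforce simp: OFG_def valid_MV_assignments_def)
qed (auto simp: OFG_def)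

lemma graph_dist_conv_length:
  assumes "wf_digraph G"
  shows "graph_dist G u v = (INF p\<in>{p. pre_digraph.awalk G u p v}. ereal (real (length p)))"
  by (simp add: graph_dist_def wf_digraph.\<mu>_def[OF assms] wf_digraph.awalk_cost_def[OF assms] sum_list_triv)

end

theory Submission
  imports Defs
begin

text \<open>
  Flipping all faces of a set \<open>F\<close> changes exactly the creases that have one of their two bordering
  faces in \<open>F\<close> and the other outside. Hence complementary sets of faces have the same effect, and
  two assignments \<open>u\<close>, \<open>v\<close> that differ in an even number of creases are related by exactly one
  complementary pair of sets; the smaller of the two has at most \<open>n\<close> faces. Valid assignments do
  differ in an even number of creases, because both sums are \<open>2\<close> modulo \<open>4\<close>
  (\<open>obtain_small_face_set\<close>).

  The order of the flips can be chosen so that every intermediate assignment is valid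
  (\<open>exists_valid_flip\<close>). If \<open>u\<close> has sum \<open>2 * \<epsilon>\<close> with \<open>\<epsilon> = 1\<close> or \<open>\<epsilon> = - 1\<close>, a flip of a single face
  destroys validity only if both its creases have sign \<open>- \<epsilon>\<close>. If this were the case for all faces of
  \<open>F\<close>, then flipping \<open>F\<close> would change creases of sign \<open>- \<epsilon>\<close> only, and would therefore move the sum
  further away from \<open>0\<close> if it changed any crease at all. The target is valid, so no crease changes;
  this forces \<open>F\<close> to consist of all faces, and then all creases have sign \<open>- \<epsilon>\<close>, contradicting the
  sum \<open>2 * \<epsilon>\<close>. Thus any two valid assignments are joined by a walk of length at most \<open>n\<close>.

  Conversely, one flip changes two creases. An assignment and its negative differ in all \<open>2 * n\<close>
  creases, so \<open>n\<close> flips are needed to get from one to the other.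
\<close>

section \<open>Flipping a set of faces\<close>

definition prev_crease :: "nat \<Rightarrow> nat \<Rightarrow> nat" where
  "prev_crease n j = (if j = 1 then 2 * n else j - 1)"

definition flip_faces :: "nat \<Rightarrow> (nat \<Rightarrow> int) \<Rightarrow> nat set \<Rightarrow> (nat \<Rightarrow> int)" where
  "flip_faces n m F =
    (\<lambda>j. if j \<in> creases n \<and> (j \<in> F) \<noteq> (prev_crease n j \<in> F) then - m j else m j)"

lemma in_face_creases_iff:
  assumes "i \<in> faces n" "j \<in> creases n"
  shows "j \<in> face_creases n i \<longleftrightarrow> i = j \<or> i = prev_crease n j"
  using assms
  by (auto simp: faces_def creases_def face_creases_def next_crease_def prev_crease_def)

lemma prev_crease_neq: "j \<in> creases n \<Longrightarrow> prev_crease n j \<noteq> j"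
  by (auto simp: creases_def prev_crease_def)

lemma prev_crease_in_faces: "j \<in> creases n \<Longrightarrow> prev_crease n j \<in> faces n"
  by (auto simp: creases_def faces_def prev_crease_def)

lemma next_crease_neq: "i \<in> faces n \<Longrightarrow> next_crease n i \<noteq> i"
  by (auto simp: faces_def next_crease_def)

lemma flip_faces_empty: "flip_faces n m {} = m"
  by (simp add: flip_faces_def)

lemma flip_faces_remove:
  assumes "i \<in> F" "F \<subseteq> faces n"
  shows "flip_faces n (flip_face n m i) (F - {i}) = flip_faces n m F"
proof
  fix j
  have i: "i \<in> faces n"
    using assms by auto
  show "flip_faces n (flip_face n m i) (F - {i}) j = flip_faces n m F j"
  proof (cases "j \<in> creases n")
    case True
    then show ?thesis
      using in_face_creases_iff[OF i True] prev_crease_neq[OF True] assms(1)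
      by (auto simp: flip_faces_def flip_face_def)
  next
    case False
    then have "j \<notin> face_creases n i"
      using face_creases_subset[OF i] by auto
    with False show ?thesis
      by (simp add: flip_faces_def flip_face_def)
  qed
qed

lemma flip_faces_complement: "flip_faces n m (faces n - F) = flip_faces n m F"
proof
  fix j
  show "flip_faces n m (faces n - F) j = flip_faces n m F j"
    using prev_crease_in_faces[of j n]
    by (auto simp: flip_faces_def faces_def creases_def)
qed

text \<open>
  If no crease separates \<open>F\<close> from its complement, then \<open>F\<close> contains with each face its two
  neighbours, and hence all faces around the vertex.
\<close>

lemma prev_closed_face_set:
  assumes "F \<subseteq> faces n" "F \<noteq> {}"
    and closed: "\<And>j. j \<in> creases n \<Longrightarrow> (j \<in> F) = (prev_crease n j \<in> F)"
  shows "F = faces n"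
proof -
  have same: "j \<in> F \<longleftrightarrow> 1 \<in> F" if "1 \<le> j" "j \<le> 2 * n" for j
    using that
  proof (induction j rule: dec_induct)
    case (step j)
    then show ?case
      using closed[of "Suc j"] by (auto simp: creases_def prev_crease_def)
  qed simp
  from assms(1,2) obtain i where "i \<in> F" "i \<in> faces n"
    by auto
  then have "1 \<in> F"
    using same[of i] by (auto simp: faces_def)
  then show ?thesis
    using assms(1) same by (auto simp: faces_def)
qed

section \<open>Flips that preserve validity\<close>

lemma MV_assignments_sign: "m \<in> MV_assignments n \<Longrightarrow> j \<in> creases n \<Longrightarrow> m j = - 1 \<or> m j = 1"
  by (auto simp: MV_assignments_def PiE_iff)

lemma valid_MV_assignments_MV: "m \<in> valid_MV_assignments n \<Longrightarrow> m \<in> MV_assignments n"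
  by (simp add: valid_MV_assignments_def)

lemma flip_face_MV:
  assumes "m \<in> MV_assignments n" "i \<in> faces n"
  shows "flip_face n m i \<in> MV_assignments n"
proof -
  have "flip_face n m i j = undefined" if "j \<notin> creases n" for j
    using that assms face_creases_subset[OF assms(2)]
    by (auto simp: flip_face_def MV_assignments_def PiE_iff extensional_def)
  then show ?thesis
    using MV_assignments_sign[OF assms(1)]
    by (fastforce simp: MV_assignments_def flip_face_def PiE_iff extensional_def)
qed

lemma sum_flip_face:
  assumes "i \<in> faces n"
  shows "(\<Sum>j\<in>creases n. flip_face n m i j) =
    (\<Sum>j\<in>creases n. m j) - 2 * (m i + m (next_crease n i))"
proof -
  have "(\<Sum>j\<in>creases n. flip_face n m i j) - (\<Sum>j\<in>creases n. m j) =
      (\<Sum>j\<in>creases n. flip_face n m i j - m j)"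
    by (simp add: sum_subtractf)
  also have "\<dots> = (\<Sum>j\<in>face_creases n i. flip_face n m i j - m j)"
    by (rule sum.mono_neutral_right)
      (use face_creases_subset[OF assms] in \<open>auto simp: creases_def flip_face_def\<close>)
  also have "\<dots> = - 2 * (m i + m (next_crease n i))"
    using next_crease_neq[OF assms] by (auto simp: face_creases_def flip_face_def)
  finally show ?thesis
    by simp
qed

text \<open>
  The factor \<open>\<epsilon>\<close> is the sign of the majority of the creases. A flip of two creases of opposite signs
  keeps the sum, and a flip of two creases of sign \<open>\<epsilon>\<close> turns it from \<open>2 * \<epsilon>\<close> into \<open>- 2 * \<epsilon>\<close>.
\<close>

lemma flip_face_valid:
  assumes m: "m \<in> MV_assignments n" and i: "i \<in> faces n"
    and \<epsilon>: "\<epsilon> = 1 \<or> \<epsilon> = - 1" and sum_m: "(\<Sum>j\<in>creases n. m j) = 2 * \<epsilon>"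
    and not_minority: "\<not> (m i = - \<epsilon> \<and> m (next_crease n i) = - \<epsilon>)"
  shows "flip_face n m i \<in> valid_MV_assignments n"
proof -
  have "i \<in> creases n" "next_crease n i \<in> creases n"
    using face_creases_subset[OF i] by (auto simp: face_creases_def)
  then have "m i = - 1 \<or> m i = 1" "m (next_crease n i) = - 1 \<or> m (next_crease n i) = 1"
    using MV_assignments_sign[OF m] by auto
  then have "(\<Sum>j\<in>creases n. flip_face n m i j) = 2 \<or> (\<Sum>j\<in>creases n. flip_face n m i j) = - 2"
    using \<epsilon> not_minority by (auto simp: sum_flip_face[OF i] sum_m)
  then show ?thesis
    using flip_face_MV[OF m i] by (simp add: valid_MV_assignments_def)
qed

text \<open>
  By the previous lemma, only faces with two minority creases cannot be flipped. If all of \<open>F\<close> were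
  of this kind, flipping \<open>F\<close> would turn minority creases into majority creases and nothing else. The
  sum of the target leaves no room for this, so \<open>F\<close> changes no crease and consists of all faces,
  which makes every crease a minority crease.
\<close>

lemma exists_valid_flip:
  assumes valid: "m \<in> valid_MV_assignments n"
    and valid_target: "flip_faces n m F \<in> valid_MV_assignments n"
    and F: "F \<subseteq> faces n" "F \<noteq> {}"
  shows "\<exists>i\<in>F. flip_face n m i \<in> valid_MV_assignments n"
proof (rule ccontr)
  assume contra: "\<not> ?thesis"
  note m = valid_MV_assignments_MV[OF valid]
  from valid obtain \<epsilon> :: int
    where \<epsilon>: "\<epsilon> = 1 \<or> \<epsilon> = - 1" and sum_m: "(\<Sum>j\<in>creases n. m j) = 2 * \<epsilon>"
    by (force simp: valid_MV_assignments_def)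
  have minority: "m j = - \<epsilon>" if i: "i \<in> F" and j: "j \<in> face_creases n i" for i j
  proof -
    have "m i = - \<epsilon> \<and> m (next_crease n i) = - \<epsilon>"
      using flip_face_valid[OF m _ \<epsilon> sum_m] contra i F(1) by blast
    then show ?thesis
      using j by (auto simp: face_creases_def)
  qed
  have minority_left: "m j = - \<epsilon>" if "j \<in> creases n" "j \<in> F" for j
    using minority[of j j] that by (simp add: face_creases_def)
  have minority_right: "m j = - \<epsilon>" if "j \<in> creases n" "prev_crease n j \<in> F" for j
    using minority[OF that(2)] in_face_creases_iff[of "prev_crease n j" n j] that F(1) by auto
  \<comment> \<open>Contribution of the crease \<open>j\<close> to the growth of the sum in the direction of the majority.\<close>
  define gain where "gain j = \<epsilon> * (flip_faces n m F j - m j)" for j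
  have gain: "gain j = (if (j \<in> F) \<noteq> (prev_crease n j \<in> F) then 2 else 0)"
    if "j \<in> creases n" for j
    using minority_left[OF that] minority_right[OF that] that \<epsilon>
    by (auto simp: gain_def flip_faces_def)
  have "(\<Sum>j\<in>creases n. gain j) =
      \<epsilon> * ((\<Sum>j\<in>creases n. flip_faces n m F j) - (\<Sum>j\<in>creases n. m j))"
    by (simp add: gain_def sum_subtractf flip: sum_distrib_left)
  also have "\<dots> \<le> 0"
    using \<epsilon> sum_m valid_target by (auto simp: valid_MV_assignments_def)
  finally have gain_le: "(\<Sum>j\<in>creases n. gain j) \<le> 0" .
  have gain_nonneg: "gain j \<ge> 0" if "j \<in> creases n" for j
    using gain[OF that] by auto
  have "gain j = 0" if "j \<in> creases n" for j
    using gain_le sum_nonneg[of "creases n" gain] sum_nonneg_eq_0_iff[of "creases n" gain]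
      gain_nonneg that
    by (simp add: creases_def)
  then have "(j \<in> F) = (prev_crease n j \<in> F)" if "j \<in> creases n" for j
    using gain[OF that] that by (auto split: if_splits)
  then have "F = faces n"
    using prev_closed_face_set[OF F] by blast
  then have "m j = - \<epsilon>" if "j \<in> creases n" for j
    using minority_left[OF that] that by (simp add: faces_def creases_def)
  then have "(\<Sum>j\<in>creases n. m j) = - (2 * int n * \<epsilon>)"
    by (simp add: creases_def)
  then have "\<epsilon> * (1 + int n) = 0"
    using sum_m by (simp add: algebra_simps)
  then show False
    using \<epsilon> by auto
qed

section \<open>The set of faces between two valid assignments\<close>

text \<open>
  The product of the signs is \<open>- 1\<close> to the number of valleys, and each valley lowers the sum
  by \<open>2\<close> from the number of creases. Thus the sum modulo \<open>4\<close> determines the product.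
\<close>

lemma sign_prod_cong_sum:
  fixes m :: "'a \<Rightarrow> int"
  assumes "finite A" "\<And>j. j \<in> A \<Longrightarrow> m j = - 1 \<or> m j = 1"
  shows "4 dvd ((\<Sum>j\<in>A. m j) - int (card A) + 1 - (\<Prod>j\<in>A. m j)) \<and>
    ((\<Prod>j\<in>A. m j) = - 1 \<or> (\<Prod>j\<in>A. m j) = 1)"
  using assms
proof (induction A rule: finite_induct)
  case (insert a A)
  then have a: "m a = - 1 \<or> m a = 1"
    and IH: "4 dvd ((\<Sum>j\<in>A. m j) - int (card A) + 1 - (\<Prod>j\<in>A. m j))"
      "(\<Prod>j\<in>A. m j) = - 1 \<or> (\<Prod>j\<in>A. m j) = 1"
    by auto
  from a show ?case
  proof
    assume "m a = 1"
    then show ?thesis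
      using insert.hyps IH by simp
  next
    assume "m a = - 1"
    with insert.hyps IH show ?thesis
      by auto presburger+
  qed
qed simp

lemma valid_prod_eq:
  assumes "u \<in> valid_MV_assignments n" "v \<in> valid_MV_assignments n"
  shows "(\<Prod>j\<in>creases n. u j) = (\<Prod>j\<in>creases n. v j)"
proof -
  have *: "4 dvd ((\<Sum>j\<in>creases n. m j) - int (card (creases n)) + 1 - (\<Prod>j\<in>creases n. m j)) \<and>
      ((\<Prod>j\<in>creases n. m j) = - 1 \<or> (\<Prod>j\<in>creases n. m j) = 1)"
    if "m \<in> valid_MV_assignments n" for m
    by (rule sign_prod_cong_sum)
      (use MV_assignments_sign[OF valid_MV_assignments_MV[OF that]] in \<open>auto simp: creases_def\<close>)
  show ?thesis
    using *[OF assms(1)] *[OF assms(2)] assms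
    by (auto simp: valid_MV_assignments_def) presburger+
qed

text \<open>
  Whether a crease separates a face in \<open>F\<close> from one outside is prescribed. Going once around the
  vertex therefore determines \<open>F\<close> from the membership of the last face, here taken to be outside;
  the tour closes up because the product over all creases is \<open>1\<close>.
\<close>

lemma obtain_face_set:
  assumes u: "u \<in> valid_MV_assignments n" and v: "v \<in> valid_MV_assignments n"
  obtains F where "F \<subseteq> faces n" "v = flip_faces n u F"
proof
  note uM = valid_MV_assignments_MV[OF u] and vM = valid_MV_assignments_MV[OF v]
  \<comment> \<open>The factor \<open>u k * v k\<close> is \<open>- 1\<close> where the assignments differ, so \<open>P j\<close> changes sign at crease
    \<open>j\<close> iff \<open>u j \<noteq> v j\<close>.\<close>
  define P where "P j = (\<Prod>k=1..j. u k * v k)" for j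
  define F where "F = {j \<in> faces n. P j = - 1}"
  show "F \<subseteq> faces n"
    by (auto simp: F_def)
  have P_Suc: "P (Suc j) = P j * (u (Suc j) * v (Suc j))" for j
    by (simp add: P_def)
  have sign: "u j = - 1 \<or> u j = 1" "v j = - 1 \<or> v j = 1" if "j \<in> creases n" for j
    using MV_assignments_sign[OF uM that] MV_assignments_sign[OF vM that] by auto
  have P_sign: "P j = - 1 \<or> P j = 1" if "j \<le> 2 * n" for j
    using that
  proof (induction j)
    case (Suc j)
    have "Suc j \<in> creases n"
      using Suc.prems by (simp add: creases_def)
    from sign[OF this] Suc show ?case
      by (auto simp: P_Suc)
  qed (simp add: P_def)
  have P_total: "P (2 * n) = 1"
  proof -
    have "P (2 * n) = (\<Prod>j\<in>creases n. v j) * (\<Prod>j\<in>creases n. v j)"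
      using valid_prod_eq[OF u v] by (simp add: P_def creases_def prod.distrib)
    also have "\<dots> = (\<Prod>j\<in>creases n. v j * v j)"
      by (simp add: prod.distrib)
    also have "\<dots> = 1"
    proof (rule prod.neutral, rule ballI)
      fix j assume "j \<in> creases n"
      then show "v j * v j = 1"
        using sign(2)[of j] by auto
    qed
    finally show ?thesis .
  qed
  show "v = flip_faces n u F"
  proof
    fix j
    show "v j = flip_faces n u F j"
    proof (cases "j \<in> creases n")
      case True
      then have "1 \<le> j" "j \<le> 2 * n"
        by (auto simp: creases_def)
      then obtain k where j: "j = Suc k"
        by (cases j) auto
      have in_F: "j \<in> F \<longleftrightarrow> P j = - 1"
        using True by (auto simp: F_def faces_def creases_def)
      have prev_in_F: "prev_crease n j \<in> F \<longleftrightarrow> P k = - 1"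
      proof (cases "k = 0")
        case True
        then show ?thesis
          using P_total by (simp add: F_def j prev_crease_def P_def)
      next
        case False
        then show ?thesis
          using \<open>j \<le> 2 * n\<close> by (simp add: F_def j prev_crease_def faces_def)
      qed
      have "P k = - 1 \<or> P k = 1"
        using P_sign \<open>j \<le> 2 * n\<close> j by simp
      then show ?thesis
        using sign[OF True] True in_F prev_in_F P_Suc[of k]
        by (auto simp: flip_faces_def j)
    next
      case False
      then show ?thesis
        using uM vM by (auto simp: flip_faces_def MV_assignments_def PiE_iff extensional_def)
    qed
  qed
qed

lemma obtain_small_face_set:
  assumes "u \<in> valid_MV_assignments n" "v \<in> valid_MV_assignments n"
  obtains F where "F \<subseteq> faces n" "card F \<le> n" "v = flip_faces n u F"
proof -
  obtain F where F: "F \<subseteq> faces n" "v = flip_faces n u F"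
    using obtain_face_set[OF assms] .
  have "card (faces n - F) = 2 * n - card F"
    using F(1) card_Diff_subset[of F "faces n"] finite_subset[OF F(1)] by (simp add: faces_def)
  then consider "card F \<le> n" | "card (faces n - F) \<le> n"
    by linarith
  then show ?thesis
  proof cases
    case 1
    with F that show ?thesis by blast
  next
    case 2
    have "v = flip_faces n u (faces n - F)"
      by (simp add: flip_faces_complement F(2))
    with 2 that[of "faces n - F"] show ?thesis by blast
  qed
qed

section \<open>Walks in the origami flip graph\<close>

lemma wf_digraph_OFG: "wf_digraph (with_proj (OFG n))"
proof -
  interpret pair_graph "OFG n" by (rule pair_graph_OFG)
  show ?thesis by unfold_locales
qed

lemma verts_OFG: "verts (with_proj (OFG n)) = valid_MV_assignments n"
  by (simp add: OFG_def)

lemma arcs_OFG_iff: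
  "(m, m') \<in> arcs (with_proj (OFG n)) \<longleftrightarrow>
    m \<in> valid_MV_assignments n \<and> m' \<in> valid_MV_assignments n \<and>
    (\<exists>i\<in>faces n. m' = flip_face n m i)"
  by (simp add: OFG_def)

text \<open>
  After a valid flip of some \<open>i \<in> F\<close>, the target is reached by the flips of \<open>F - {i}\<close>, so valid
  flips can be chosen greedily and each face of \<open>F\<close> is used exactly once.
\<close>

lemma awalk_along_face_set:
  assumes "u \<in> valid_MV_assignments n" "flip_faces n u F \<in> valid_MV_assignments n"
    and "F \<subseteq> faces n"
  shows "\<exists>p. pre_digraph.awalk (with_proj (OFG n)) u p (flip_faces n u F) \<and> length p = card F"
  using assms
proof (induction "card F" arbitrary: u F)
  case 0
  interpret wf_digraph "with_proj (OFG n)" by (rule wf_digraph_OFG)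
  have "finite F"
    using 0 finite_subset by (fastforce simp: faces_def)
  then have "F = {}"
    using 0 by simp
  moreover have "awalk u [] u"
    using 0 by (simp add: awalk_Nil_iff verts_OFG del: with_proj_simps)
  ultimately show ?case
    by (auto simp: flip_faces_empty intro!: exI[of _ "[]"])
next
  case (Suc k)
  interpret wf_digraph "with_proj (OFG n)" by (rule wf_digraph_OFG)
  have "F \<noteq> {}"
    using Suc.hyps(2) by auto
  then obtain i where i: "i \<in> F" and valid: "flip_face n u i \<in> valid_MV_assignments n"
    using exists_valid_flip Suc.prems by blast
  have rest: "flip_faces n (flip_face n u i) (F - {i}) = flip_faces n u F"
    using flip_faces_remove[OF i Suc.prems(3)] .
  have card: "k = card (F - {i})"
    using Suc.hyps(2) i by simp
  have "\<exists>p. awalk (flip_face n u i) p (flip_faces n u F) \<and> length p = card (F - {i})"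
    using Suc.hyps(1)[OF card valid] rest Suc.prems by fastforce
  then obtain p where p: "awalk (flip_face n u i) p (flip_faces n u F)" "length p = k"
    using card by auto
  have "(u, flip_face n u i) \<in> arcs (with_proj (OFG n))"
    unfolding arcs_OFG_iff using Suc.prems(1,3) valid i by blast
  then have "awalk u ((u, flip_face n u i) # p) (flip_faces n u F)"
    using p(1) by (simp add: awalk_Cons_iff)
  then show ?case
    using p(2) Suc.hyps(2) by (intro exI[of _ "(u, flip_face n u i) # p"]) auto
qed

lemma exists_short_awalk:
  assumes "u \<in> valid_MV_assignments n" "v \<in> valid_MV_assignments n"
  shows "\<exists>p. pre_digraph.awalk (with_proj (OFG n)) u p v \<and> length p \<le> n"
proof -
  obtain F where F: "F \<subseteq> faces n" "card F \<le> n" "v = flip_faces n u F"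
    using obtain_small_face_set[OF assms] .
  show ?thesis
    using awalk_along_face_set[OF assms(1) _ F(1)] assms(2) F(2,3) by auto
qed

text \<open>Each step of a walk changes only the two creases of one face.\<close>

lemma hamming_distance_le_awalk:
  assumes "pre_digraph.awalk (with_proj (OFG n)) u p v"
  shows "card {j \<in> creases n. u j \<noteq> v j} \<le> 2 * length p"
  using assms
proof (induction p arbitrary: u)
  case Nil
  interpret wf_digraph "with_proj (OFG n)" by (rule wf_digraph_OFG)
  show ?case
    using Nil by (simp add: awalk_Nil_iff)
next
  case (Cons e p)
  interpret wf_digraph "with_proj (OFG n)" by (rule wf_digraph_OFG)
  obtain w where e: "e = (u, w)" and arc: "(u, w) \<in> arcs (with_proj (OFG n))"
    and p: "awalk w p v"
    using Cons.prems by (cases e) (auto simp: awalk_Cons_iff)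
  obtain i where i: "i \<in> faces n" "w = flip_face n u i"
    using arc unfolding arcs_OFG_iff by blast
  have "{j \<in> creases n. u j \<noteq> v j} \<subseteq> face_creases n i \<union> {j \<in> creases n. w j \<noteq> v j}"
    by (auto simp: i(2) flip_face_def)
  then have "card {j \<in> creases n. u j \<noteq> v j} \<le>
      card (face_creases n i \<union> {j \<in> creases n. w j \<noteq> v j})"
    by (rule card_mono[rotated]) (simp add: face_creases_def creases_def)
  also have "\<dots> \<le> card (face_creases n i) + card {j \<in> creases n. w j \<noteq> v j}"
    by (rule card_Un_le)
  also have "card (face_creases n i) \<le> 2"
    by (simp add: face_creases_def card_insert_if)
  also have "card {j \<in> creases n. w j \<noteq> v j} \<le> 2 * length p"
    using Cons.IH[OF p] .
  finally show ?case
    by simp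
qed

lemma obtain_antipodal_valid:
  assumes "n \<ge> 1"
  obtains u v where "u \<in> valid_MV_assignments n" "v \<in> valid_MV_assignments n"
    "\<And>j. j \<in> creases n \<Longrightarrow> u j \<noteq> v j"
proof
  \<comment> \<open>With \<open>n + 1\<close> mountains and \<open>n - 1\<close> valleys the sum is \<open>2\<close>; the negative has sum \<open>- 2\<close>.\<close>
  define s :: "nat \<Rightarrow> int" where "s j = (if j \<le> n + 1 then 1 else - 1)" for j
  have "(\<Sum>j\<in>creases n. s j) = (\<Sum>j=1..n+1. s j) + (\<Sum>j=n+2..2*n. s j)"
  proof -
    have "creases n = {1..n+1} \<union> {n+2..2*n}"
      using assms by (auto simp: creases_def)
    then show ?thesis
      by (simp add: sum.union_disjoint)
  qed
  also have "\<dots> = 2"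
    using assms by (simp add: s_def)
  finally have sum_s: "(\<Sum>j\<in>creases n. s j) = 2" .
  have MV: "restrict (\<lambda>j. c * s j) (creases n) \<in> MV_assignments n" if "c = 1 \<or> c = - 1" for c
    using that by (auto simp: MV_assignments_def s_def split: if_splits)
  have "(\<Sum>j\<in>creases n. restrict (\<lambda>j. c * s j) (creases n) j) = 2 * c" for c
    by (simp add: sum_s flip: sum_distrib_left)
  then have valid: "restrict (\<lambda>j. c * s j) (creases n) \<in> valid_MV_assignments n"
    if "c = 1 \<or> c = - 1" for c
    using MV[OF that] that by (auto simp: valid_MV_assignments_def)
  show "restrict (\<lambda>j. 1 * s j) (creases n) \<in> valid_MV_assignments n"
    "restrict (\<lambda>j. - 1 * s j) (creases n) \<in> valid_MV_assignments n"
    by (rule valid; simp)+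
  show "restrict (\<lambda>j. 1 * s j) (creases n) j \<noteq> restrict (\<lambda>j. - 1 * s j) (creases n) j"
    if "j \<in> creases n" for j
    using that by (simp add: s_def)
qed

section \<open>Connectedness and diameter\<close>

theorem theorem4p1:
  fixes n :: nat
  assumes "n \<ge> 1"
  shows "Digraph_Component.connected (with_proj (OFG n)) \<and>
         diameter (with_proj (OFG n)) = ereal (real n)"
proof -
  interpret wf_digraph "with_proj (OFG n)" by (rule wf_digraph_OFG)
  obtain u v where uv: "u \<in> valid_MV_assignments n" "v \<in> valid_MV_assignments n"
    and differ: "\<And>j. j \<in> creases n \<Longrightarrow> u j \<noteq> v j"
    using obtain_antipodal_valid[OF assms] by metis
  have "Digraph_Component.connected (with_proj (OFG n))"
  proof (rule connectedI)
    show "verts (with_proj (OFG n)) \<noteq> {}"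
      using uv(1) verts_OFG by blast
    fix a b
    assume "a \<in> verts (with_proj (OFG n))" "b \<in> verts (with_proj (OFG n))"
    then have "a \<rightarrow>\<^sup>*\<^bsub>with_proj (OFG n)\<^esub> b"
      using exists_short_awalk verts_OFG reachable_awalk by blast
    then show "a \<rightarrow>\<^sup>*\<^bsub>mk_symmetric (with_proj (OFG n))\<^esub> b"
      by (rule reachable_mk_symmetricI)
  qed
  moreover have "diameter (with_proj (OFG n)) \<le> ereal (real n)"
    unfolding diameter_def
  proof (intro SUP_least)
    fix a b
    assume "a \<in> verts (with_proj (OFG n))" "b \<in> verts (with_proj (OFG n))"
    then obtain p where "awalk a p b" "length p \<le> n"
      using exists_short_awalk verts_OFG by blast
    then show "graph_dist (with_proj (OFG n)) a b \<le> ereal (real n)"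
      unfolding graph_dist_conv_length[OF wf_digraph_OFG] by (intro INF_lower2[of p]) auto
  qed
  moreover have "ereal (real n) \<le> diameter (with_proj (OFG n))"
  proof -
    have "n \<le> length p" if "awalk u p v" for p
    proof -
      have "{j \<in> creases n. u j \<noteq> v j} = creases n"
        using differ by auto
      then show ?thesis
        using hamming_distance_le_awalk[OF that] by (simp add: creases_def)
    qed
    then have "ereal (real n) \<le> graph_dist (with_proj (OFG n)) u v"
      unfolding graph_dist_conv_length[OF wf_digraph_OFG] by (intro INF_greatest) auto
    also have "\<dots> \<le> diameter (with_proj (OFG n))"
      unfolding diameter_def using uv verts_OFG
      by (intro SUP_upper2[of u] SUP_upper2[of v]) auto
    finally show ?thesis .
  qed
  ultimately show ?thesis
    by (auto intro: antisym)
qed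

end
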